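(* Let $\alpha,\beta\in\mathbb{R}$ with $\alpha\neq 0$, and let $(G_1,g,J)$ be the connected, simply connected three-dimensional Lie group with left-invariant Lorentzian metric $g$ whose Lie algebra $\mathfrak{g}$ has a pseudo-orthonormal basis $\{e_1,e_2,e_3\}$ with $e_3$ timelike such that $$[e_1,e_2]=\alpha e_1-\beta e_3,\quad [e_1,e_3]=-\alpha e_1-\beta e_2,\quad [e_2,e_3]=\beta e_1+\alpha e_2+\alpha e_3,$$ equipped with the product structure $Je_1=e_1$, $Je_2=e_2$, $Je_3=-e_3$. Then $(G_1,g,J)$ is not a first kind algebraic Wanas soliton associated to the canonical connection $\nabla^0$; that is, there are no real number $c$ and derivation $D$ of $\mathfrak{g}$ with $\mathrm{Wan}^0=c\,\mathrm{Id}+D$.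
   Context: Pseudo-orthonormal with $e_3$ timelike means $g(e_1,e_1)=g(e_2,e_2)=1$, $g(e_3,e_3)=-1$, $g(e_i,e_j)=0$ for $i\ne j$. All tensors are left-invariant and evaluated on the Lie algebra $\mathfrak{g}$ of left-invariant vector fields. Let $\nabla$ be the Levi-Civita connection of $g$, and let $J$ be the product structure given in the claim, with $(\nabla_XJ)Y=\nabla_X(JY)-J(\nabla_XY)$. Canonical connection: $\nabla^0_XY=\nabla_XY-\frac12(\nabla_XJ)JY$. Curvature: $R^0(X,Y)Z=\nabla^0_X\nabla^0_YZ-\nabla^0_Y\nabla^0_XZ-\nabla^0_{[X,Y]}Z$. Torsion: $T^0(X,Y)=\nabla^0_XY-\nabla^0_YX-[X,Y]$. $A^0(X,Y)Z=T^0(T^0(X,Y),Z)$, and the Wanas tensor is $W^0(X,Y)Z=R^0(X,Y)Z-A^0(X,Y)Z$. $w^0(X,Y)=-g(W^0(X,e_1)Y,e_1)-g(W^0(X,e_2)Y,e_2)+g(W^0(X,e_3)Y,e_3)$. The operator $\mathrm{Wan}^0:\mathfrak g\to\mathfrak g$ is defined by $w^0(X,Y)=g(\mathrm{Wan}^0(X),Y)$. A derivation of $\mathfrak g$ is a linear map $D$ with $D[X,Y]=[DX,Y]+[X,DY]$ for all $X,Y\in\mathfrak g$. $(G_1,g,J)$ is a first kind algebraic Wanas soliton associated to $\nabla^0$ if $\mathrm{Wan}^0=c\,\mathrm{Id}+D$ for a real number $c$ and a derivation $D$ of $\mathfrak g$. *)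

theory Defs
  imports "HOL-Analysis.Analysis"
begin

text \<open>
  A connected, simply connected Lie group with left-invariant metric and left-invariant product
  structure is represented by its Lie algebra of left-invariant vector fields: a real vector space
  (the type \<^typ>\<open>'a\<close>) with bracket \<open>br\<close>, scalar product \<open>g\<close> and linear map \<open>J\<close>.
  Left-invariant connections and tensors are multilinear maps on that space.
\<close>

definition lie_bracket :: "('a::real_vector \<Rightarrow> 'a \<Rightarrow> 'a) \<Rightarrow> bool" where
  "lie_bracket br \<longleftrightarrow> bilinear br \<and> (\<forall>X. br X X = 0) \<and>
     (\<forall>X Y Z. br X (br Y Z) + br Y (br Z X) + br Z (br X Y) = 0)"

definition lie_derivation :: "('a::real_vector \<Rightarrow> 'a \<Rightarrow> 'a) \<Rightarrow> ('a \<Rightarrow> 'a) \<Rightarrow> bool" where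
  "lie_derivation br D \<longleftrightarrow> linear D \<and> (\<forall>X Y. D (br X Y) = br (D X) Y + br X (D Y))"

definition left_invariant_metric :: "('a::real_vector \<Rightarrow> 'a \<Rightarrow> real) \<Rightarrow> bool" where
  "left_invariant_metric g \<longleftrightarrow> bilinear g \<and> (\<forall>X Y. g X Y = g Y X) \<and>
     (\<forall>X. (\<forall>Y. g X Y = 0) \<longrightarrow> X = 0)"

definition pseudo_orthonormal_basis ::
    "('a::real_vector \<Rightarrow> 'a \<Rightarrow> real) \<Rightarrow> 'a \<Rightarrow> 'a \<Rightarrow> 'a \<Rightarrow> bool" where
  "pseudo_orthonormal_basis g e1 e2 e3 \<longleftrightarrow>
     distinct [e1, e2, e3] \<and> independent {e1, e2, e3} \<and> span {e1, e2, e3} = UNIV \<and>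
     g e1 e1 = 1 \<and> g e2 e2 = 1 \<and> g e3 e3 = -1 \<and>
     g e1 e2 = 0 \<and> g e1 e3 = 0 \<and> g e2 e3 = 0"

text \<open>
  Metric compatibility \<open>X(g(Y,Z)) = g(nab X Y, Z) + g(Y, nab X Z)\<close> has left-hand side \<open>0\<close>
  because \<open>g(Y,Z)\<close> is a constant function for left-invariant \<open>Y\<close>, \<open>Z\<close>.
\<close>

definition is_levi_civita ::
    "('a::real_vector \<Rightarrow> 'a \<Rightarrow> 'a) \<Rightarrow> ('a \<Rightarrow> 'a \<Rightarrow> real) \<Rightarrow> ('a \<Rightarrow> 'a \<Rightarrow> 'a) \<Rightarrow> bool" where
  "is_levi_civita br g nab \<longleftrightarrow> bilinear nab \<and>
     (\<forall>X Y. nab X Y - nab Y X = br X Y) \<and>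
     (\<forall>X Y Z. g (nab X Y) Z + g Y (nab X Z) = 0)"

definition levi_civita ::
    "('a::real_vector \<Rightarrow> 'a \<Rightarrow> 'a) \<Rightarrow> ('a \<Rightarrow> 'a \<Rightarrow> real) \<Rightarrow> 'a \<Rightarrow> 'a \<Rightarrow> 'a" where
  "levi_civita br g = (THE nab. is_levi_civita br g nab)"

definition covariant_derivative_endo ::
    "('a::real_vector \<Rightarrow> 'a \<Rightarrow> 'a) \<Rightarrow> ('a \<Rightarrow> 'a) \<Rightarrow> 'a \<Rightarrow> 'a \<Rightarrow> 'a" where
  "covariant_derivative_endo nab J X Y = nab X (J Y) - J (nab X Y)"

definition canonical_connection ::
    "('a::real_vector \<Rightarrow> 'a \<Rightarrow> 'a) \<Rightarrow> ('a \<Rightarrow> 'a \<Rightarrow> real) \<Rightarrow> ('a \<Rightarrow> 'a) \<Rightarrow> 'a \<Rightarrow> 'a \<Rightarrow> 'a" where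
  "canonical_connection br g J X Y =
     levi_civita br g X Y - (1/2) *\<^sub>R covariant_derivative_endo (levi_civita br g) J X (J Y)"

definition curvature ::
    "('a::real_vector \<Rightarrow> 'a \<Rightarrow> 'a) \<Rightarrow> ('a \<Rightarrow> 'a \<Rightarrow> 'a) \<Rightarrow> 'a \<Rightarrow> 'a \<Rightarrow> 'a \<Rightarrow> 'a" where
  "curvature br nab X Y Z = nab X (nab Y Z) - nab Y (nab X Z) - nab (br X Y) Z"

definition torsion ::
    "('a::real_vector \<Rightarrow> 'a \<Rightarrow> 'a) \<Rightarrow> ('a \<Rightarrow> 'a \<Rightarrow> 'a) \<Rightarrow> 'a \<Rightarrow> 'a \<Rightarrow> 'a" where
  "torsion br nab X Y = nab X Y - nab Y X - br X Y"

definition wanas_tensor ::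
    "('a::real_vector \<Rightarrow> 'a \<Rightarrow> 'a) \<Rightarrow> ('a \<Rightarrow> 'a \<Rightarrow> 'a) \<Rightarrow> 'a \<Rightarrow> 'a \<Rightarrow> 'a \<Rightarrow> 'a" where
  "wanas_tensor br nab X Y Z =
     curvature br nab X Y Z - torsion br nab (torsion br nab X Y) Z"

definition wanas_form ::
    "('a::real_vector \<Rightarrow> 'a \<Rightarrow> 'a) \<Rightarrow> ('a \<Rightarrow> 'a \<Rightarrow> real) \<Rightarrow> ('a \<Rightarrow> 'a \<Rightarrow> 'a) \<Rightarrow>
     'a \<Rightarrow> 'a \<Rightarrow> 'a \<Rightarrow> 'a \<Rightarrow> 'a \<Rightarrow> real" where
  "wanas_form br g nab e1 e2 e3 X Y =
     - g (wanas_tensor br nab X e1 Y) e1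
     - g (wanas_tensor br nab X e2 Y) e2
     + g (wanas_tensor br nab X e3 Y) e3"

definition wanas_operator ::
    "('a::real_vector \<Rightarrow> 'a \<Rightarrow> 'a) \<Rightarrow> ('a \<Rightarrow> 'a \<Rightarrow> real) \<Rightarrow> ('a \<Rightarrow> 'a \<Rightarrow> 'a) \<Rightarrow>
     'a \<Rightarrow> 'a \<Rightarrow> 'a \<Rightarrow> 'a \<Rightarrow> 'a" where
  "wanas_operator br g nab e1 e2 e3 =
     (THE W. \<forall>X Y. wanas_form br g nab e1 e2 e3 X Y = g (W X) Y)"

definition first_kind_algebraic_wanas_soliton ::
    "('a::real_vector \<Rightarrow> 'a \<Rightarrow> 'a) \<Rightarrow> ('a \<Rightarrow> 'a \<Rightarrow> real) \<Rightarrow> ('a \<Rightarrow> 'a) \<Rightarrow>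
     'a \<Rightarrow> 'a \<Rightarrow> 'a \<Rightarrow> bool" where
  "first_kind_algebraic_wanas_soliton br g J e1 e2 e3 \<longleftrightarrow>
     (\<exists>(c::real) D. lie_derivation br D \<and>
        (\<forall>X. wanas_operator br g (canonical_connection br g J) e1 e2 e3 X = c *\<^sub>R X + D X))"

text \<open>The two definite descriptions above denote.\<close>

lemma pseudo_orthonormal_expansion:
  assumes g: "left_invariant_metric g" and e: "pseudo_orthonormal_basis g e1 e2 e3"
  shows "X = g X e1 *\<^sub>R e1 + g X e2 *\<^sub>R e2 - g X e3 *\<^sub>R e3"
proof -
  have bl: "bilinear g" and sy: "\<And>X Y. g X Y = g Y X" using g by (auto simp: left_invariant_metric_def)
  have "X \<in> span {e1, e2, e3}" using e by (auto simp: pseudo_orthonormal_basis_def)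
  then obtain a b c where X: "X = a *\<^sub>R e1 + b *\<^sub>R e2 + c *\<^sub>R e3"
    by (auto simp: span_insert span_singleton algebra_simps)
  note s = bilinear_ladd[OF bl] bilinear_lmul[OF bl] X
  have "g X e1 = a" "g X e2 = b" "g X e3 = - c"
    using e sy[of e2 e1] sy[of e3 e1] sy[of e3 e2]
    unfolding pseudo_orthonormal_basis_def by (simp_all add: s)
  then show ?thesis using X by simp
qed

lemma left_invariant_metric_eqI:
  assumes g: "left_invariant_metric g" and "\<And>Y. g X Y = g X' Y"
  shows "X = X'"
proof -
  have "g (X - X') Y = 0" for Y
    using g assms(2)[of Y] bilinear_lsub[of g X X' Y] by (simp add: left_invariant_metric_def)
  then show ?thesis using g unfolding left_invariant_metric_def by (metis right_minus_eq)
qed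

lemma represent_linear_form:
  assumes g: "left_invariant_metric g" and e: "pseudo_orthonormal_basis g e1 e2 e3" and f: "linear f"
  shows "g (f e1 *\<^sub>R e1 + f e2 *\<^sub>R e2 - f e3 *\<^sub>R e3) Y = f Y"
proof -
  have bl: "bilinear g" and sy: "\<And>X Y. g X Y = g Y X" using g by (auto simp: left_invariant_metric_def)
  have "f Y = f (g Y e1 *\<^sub>R e1 + g Y e2 *\<^sub>R e2 - g Y e3 *\<^sub>R e3)"
    using pseudo_orthonormal_expansion[OF g e, of Y] by simp
  also have "\<dots> = g Y e1 * f e1 + g Y e2 * f e2 - g Y e3 * f e3"
    by (simp add: linear_add[OF f] linear_diff[OF f] linear_scale[OF f])
  finally show ?thesis
    by (simp add: bilinear_ladd[OF bl] bilinear_lsub[OF bl] bilinear_lmul[OF bl] sy[of Y e1] sy[of Y e2] sy[of Y e3] mult.commute)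
qed

lemma levi_civita_koszul:
  assumes g: "left_invariant_metric g" and n: "is_levi_civita br g nab"
  shows "2 * g (nab X Y) Z = g (br X Y) Z - g (br Y Z) X + g (br Z X) Y"
proof -
  have bl: "bilinear g" and sy: "\<And>X Y. g X Y = g Y X" using g by (auto simp: left_invariant_metric_def)
  have t: "br X Y = nab X Y - nab Y X" for X Y using n by (auto simp: is_levi_civita_def)
  have m: "g (nab X Y) Z + g (nab X Z) Y = 0" for X Y Z
    using n sy by (metis is_levi_civita_def)
  show ?thesis using m[of X Y Z] m[of Y X Z] m[of Z X Y]
    by (simp add: t bilinear_lsub[OF bl])
qed

lemma is_levi_civita_ex1:
  assumes br: "lie_bracket br" and g: "left_invariant_metric g"
    and e: "pseudo_orthonormal_basis g e1 e2 e3"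
  shows "\<exists>!nab. is_levi_civita br g nab"
proof (rule ex_ex1I)
  have blg: "bilinear g" and sy: "\<And>X Y. g X Y = g Y X" using g by (auto simp: left_invariant_metric_def)
  have blb: "bilinear br" and alt: "\<And>X. br X X = 0" using br by (auto simp: lie_bracket_def)
  note s = bilinear_ladd[OF blg] bilinear_lsub[OF blg] bilinear_lmul[OF blg]
    bilinear_radd[OF blg] bilinear_rsub[OF blg] bilinear_rmul[OF blg]
    bilinear_ladd[OF blb] bilinear_lmul[OF blb] bilinear_radd[OF blb] bilinear_rmul[OF blb]
  have anti: "br X Y = - br Y X" for X Y
    using alt[of "X + Y"] alt[of X] alt[of Y] by (simp add: s eq_neg_iff_add_eq_0 add.commute)
  define K where "K X Y Z = (g (br X Y) Z - g (br Y Z) X + g (br Z X) Y) / 2" for X Y Z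
  have linK: "linear (K X Y)" for X Y
    by (rule linearI) (simp_all add: K_def s field_simps)
  define nab where "nab X Y = K X Y e1 *\<^sub>R e1 + K X Y e2 *\<^sub>R e2 - K X Y e3 *\<^sub>R e3" for X Y
  have nab: "g (nab X Y) Z = K X Y Z" for X Y Z
    unfolding nab_def by (rule represent_linear_form[OF g e linK])
  have lin1: "linear (\<lambda>X. nab X Y)" for Y
    by (rule linearI; rule left_invariant_metric_eqI[OF g])
      (simp_all add: s nab K_def field_simps)
  have lin2: "linear (nab X)" for X
    by (rule linearI; rule left_invariant_metric_eqI[OF g])
      (simp_all add: s nab K_def field_simps)
  have neg: "g (- X) Y = - g X Y" for X Y by (rule bilinear_lneg[OF blg])
  have tor: "nab X Y - nab Y X = br X Y" for X Y
  proof (rule left_invariant_metric_eqI[OF g])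
    fix Z
    show "g (nab X Y - nab Y X) Z = g (br X Y) Z"
      using anti[of Y X] anti[of X Z] anti[of Z Y] by (simp add: s nab K_def neg field_simps)
  qed
  have met: "g (nab X Y) Z + g Y (nab X Z) = 0" for X Y Z
    using anti[of X Z] anti[of Z Y] anti[of Y X]
    by (simp add: sy[of Y "nab X Z"] nab K_def neg field_simps)
  show "\<exists>nab. is_levi_civita br g nab"
    using lin1 lin2 tor met unfolding is_levi_civita_def bilinear_def by blast
next
  fix n n' assume n: "is_levi_civita br g n" "is_levi_civita br g n'"
  show "n = n'"
  proof (intro ext left_invariant_metric_eqI[OF g])
    fix X Y Z show "g (n X Y) Z = g (n' X Y) Z"
      using levi_civita_koszul[OF g n(1), of X Y Z] levi_civita_koszul[OF g n(2), of X Y Z] by simp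
  qed
qed

lemma levi_civita:
  assumes "lie_bracket br" "left_invariant_metric g" "pseudo_orthonormal_basis g e1 e2 e3"
  shows "is_levi_civita br g (levi_civita br g)"
  unfolding levi_civita_def by (rule theI'[OF is_levi_civita_ex1[OF assms]])

lemma wanas_operator:
  assumes br: "lie_bracket br" and g: "left_invariant_metric g"
    and e: "pseudo_orthonormal_basis g e1 e2 e3" and J: "linear J"
  shows "wanas_form br g (canonical_connection br g J) e1 e2 e3 X Y =
         g (wanas_operator br g (canonical_connection br g J) e1 e2 e3 X) Y"
proof -
  let ?n = "levi_civita br g" and ?c = "canonical_connection br g J"
  let ?w = "wanas_form br g ?c e1 e2 e3"
  have blg: "bilinear g" using g by (auto simp: left_invariant_metric_def)
  have blb: "bilinear br" using br by (auto simp: lie_bracket_def)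
  have bln: "bilinear ?n" using levi_civita[OF br g e] by (auto simp: is_levi_civita_def)
  note s = bilinear_ladd bilinear_lsub bilinear_lmul bilinear_radd bilinear_rsub bilinear_rmul
  have blc: "bilinear ?c" unfolding bilinear_def
    by (intro allI conjI linearI)
      (simp_all add: canonical_connection_def covariant_derivative_endo_def s[OF bln]
        linear_add[OF J] linear_scale[OF J] algebra_simps)
  have lin: "linear (?w X)" for X
    by (rule linearI)
      (simp_all add: wanas_form_def wanas_tensor_def curvature_def torsion_def
        s[OF blg] s[OF blb] s[OF blc] algebra_simps)
  have "\<exists>!W. \<forall>X Y. ?w X Y = g (W X) Y"
  proof (rule ex_ex1I)
    show "\<exists>W. \<forall>X Y. ?w X Y = g (W X) Y"
      using represent_linear_form[OF g e lin]
      by (intro exI[of _ "\<lambda>X. ?w X e1 *\<^sub>R e1 + ?w X e2 *\<^sub>R e2 - ?w X e3 *\<^sub>R e3"]) simp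
  next
    fix W W' assume "\<forall>X Y. ?w X Y = g (W X) Y" "\<forall>X Y. ?w X Y = g (W' X) Y"
    then show "W = W'" by (intro ext left_invariant_metric_eqI[OF g]) simp
  qed
  from theI'[OF this] show ?thesis unfolding wanas_operator_def by blast
qed

end

theory Submission
  imports Defs
begin

text \<open>
  In the basis \<open>e1, e2, e3\<close> the operator \<open>Wan\<close> has entries quadratic in \<open>\<alpha>, \<beta>\<close>.  If
  \<open>D = Wan - c Id\<close> is a derivation, the \<open>e2\<close>-coordinate of \<open>D[e1,e2] = [D e1,e2] + [e1,D e2]\<close>
  reads \<open>\<alpha>\<^sup>2 \<beta> / 2 = 0\<close>, so \<open>\<beta> = 0\<close>.  The \<open>e1\<close>-coordinates of the same identity and of the one
  for \<open>[e1,e3]\<close> then become \<open>\<alpha>\<^sup>3 + \<alpha> c = 0\<close> and \<open>\<alpha> c = 0\<close>, whence \<open>\<alpha> = 0\<close>.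
\<close>

locale lorentzian_G1 =
  fixes \<alpha> \<beta> :: real
    and br :: "'a::real_vector \<Rightarrow> 'a \<Rightarrow> 'a"
    and g :: "'a \<Rightarrow> 'a \<Rightarrow> real"
    and J :: "'a \<Rightarrow> 'a"
    and e1 e2 e3 :: 'a
  assumes lie: "lie_bracket br"
    and metric: "left_invariant_metric g"
    and basis: "pseudo_orthonormal_basis g e1 e2 e3"
    and br12: "br e1 e2 = \<alpha> *\<^sub>R e1 - \<beta> *\<^sub>R e3"
    and br13: "br e1 e3 = - (\<alpha> *\<^sub>R e1) - \<beta> *\<^sub>R e2"
    and br23: "br e2 e3 = \<beta> *\<^sub>R e1 + \<alpha> *\<^sub>R e2 + \<alpha> *\<^sub>R e3"
    and J_linear: "linear J"
    and J_basis: "J e1 = e1" "J e2 = e2" "J e3 = - e3"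
begin

abbreviation nab where "nab \<equiv> levi_civita br g"
abbreviation con where "con \<equiv> canonical_connection br g J"
abbreviation tor where "tor \<equiv> torsion br con"
abbreviation wform where "wform \<equiv> wanas_form br g con e1 e2 e3"
abbreviation Wan where "Wan \<equiv> wanas_operator br g con e1 e2 e3"

lemma bilinear_g: "bilinear g" and bilinear_br: "bilinear br"
  using metric lie by (auto simp: left_invariant_metric_def lie_bracket_def)

lemma g_sym: "g X Y = g Y X"
  using metric by (auto simp: left_invariant_metric_def)

lemma bilinear_nab: "bilinear nab"
  using levi_civita[OF lie metric basis] by (auto simp: is_levi_civita_def)

lemmas bilinear_simps =
  bilinear_ladd bilinear_lsub bilinear_lmul bilinear_lneg bilinear_lzero
  bilinear_radd bilinear_rsub bilinear_rmul bilinear_rneg bilinear_rzero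

lemmas g_simps = bilinear_simps[OF bilinear_g]
lemmas br_simps = bilinear_simps[OF bilinear_br]
lemmas nab_simps = bilinear_simps[OF bilinear_nab]
lemmas J_simps = linear_add[OF J_linear] linear_diff[OF J_linear] linear_scale[OF J_linear]
  linear_neg[OF J_linear] linear_0[OF J_linear] J_basis

lemma bilinear_con: "bilinear con"
  unfolding bilinear_def
  by (intro allI conjI linearI)
    (simp_all add: canonical_connection_def covariant_derivative_endo_def nab_simps J_simps
      algebra_simps)

lemmas con_simps = bilinear_simps[OF bilinear_con]

lemma g_basis:
  "g e1 e1 = 1" "g e2 e2 = 1" "g e3 e3 = -1"
  "g e1 e2 = 0" "g e1 e3 = 0" "g e2 e3 = 0" "g e2 e1 = 0" "g e3 e1 = 0" "g e3 e2 = 0"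
  using basis g_sym[of e2 e1] g_sym[of e3 e1] g_sym[of e3 e2]
  by (auto simp: pseudo_orthonormal_basis_def)

lemma br_alternating: "br X X = 0"
  using lie by (auto simp: lie_bracket_def)

lemma br_antisym: "br X Y = - br Y X"
proof -
  have "br (X + Y) (X + Y) = br X X + br Y Y + (br X Y + br Y X)"
    by (simp only: br_simps add_ac)
  then show ?thesis
    unfolding br_alternating by (simp add: eq_neg_iff_add_eq_0)
qed

text \<open>As a rewrite rule \<open>br_antisym\<close> would only permute arguments, so the
  reversed brackets are instantiated one by one.\<close>

lemmas br_basis = br_alternating br12 br13 br23
  trans[OF br_antisym arg_cong[where f = uminus, OF br12]]
  trans[OF br_antisym arg_cong[where f = uminus, OF br13]]
  trans[OF br_antisym arg_cong[where f = uminus, OF br23]]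

lemma eq_by_coordinates:
  assumes "g X e1 = g Y e1" "g X e2 = g Y e2" "g X e3 = g Y e3"
  shows "X = Y"
  using pseudo_orthonormal_expansion[OF metric basis, of X]
    pseudo_orthonormal_expansion[OF metric basis, of Y] assms by simp

text \<open>The Koszul formula in solved form: it replaces the definite description of
  \<open>nab\<close> by brackets, so the connection can be read off from the structure
  equations.\<close>

lemma g_nab: "g (nab X Y) Z = (g (br X Y) Z - g (br Y Z) X + g (br Z X) Y) / 2"
  using levi_civita_koszul[OF metric levi_civita[OF lie metric basis], of X Y Z] by simp

lemma nab_basis:
  "nab e1 e1 = - (\<alpha> *\<^sub>R e2) - \<alpha> *\<^sub>R e3"
  "nab e1 e2 = \<alpha> *\<^sub>R e1 - (\<beta> / 2) *\<^sub>R e3"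
  "nab e1 e3 = - (\<alpha> *\<^sub>R e1) - (\<beta> / 2) *\<^sub>R e2"
  "nab e2 e1 = (\<beta> / 2) *\<^sub>R e3"
  "nab e2 e2 = \<alpha> *\<^sub>R e3"
  "nab e2 e3 = (\<beta> / 2) *\<^sub>R e1 + \<alpha> *\<^sub>R e2"
  "nab e3 e1 = (\<beta> / 2) *\<^sub>R e2"
  "nab e3 e2 = - ((\<beta> / 2) *\<^sub>R e1) - \<alpha> *\<^sub>R e3"
  "nab e3 e3 = - (\<alpha> *\<^sub>R e2)"
  by (rule eq_by_coordinates; simp add: g_nab g_simps g_basis br_basis)+

text \<open>As \<open>J\<close> squares to the identity, \<open>con X Y\<close> equals half of
  \<open>nab X Y + J (nab X (J Y))\<close>. This projects \<open>nab X Y\<close> onto the span of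
  \<open>e1\<close>, \<open>e2\<close> for \<open>Y\<close> in that span, and onto the line of
  \<open>e3\<close> for \<open>Y = e3\<close>. The latter part vanishes, since metric compatibility
  gives \<open>g (nab X e3) e3 = 0\<close>.\<close>

lemma con_basis:
  "con e1 e1 = - (\<alpha> *\<^sub>R e2)"
  "con e1 e2 = \<alpha> *\<^sub>R e1"
  "con e1 e3 = 0"
  "con e2 e1 = 0"
  "con e2 e2 = 0"
  "con e2 e3 = 0"
  "con e3 e1 = (\<beta> / 2) *\<^sub>R e2"
  "con e3 e2 = - ((\<beta> / 2) *\<^sub>R e1)"
  "con e3 e3 = 0"
  by (simp_all add: canonical_connection_def covariant_derivative_endo_def nab_basis nab_simps
      J_simps algebra_simps flip: scaleR_left.add)

lemma tor_basis:
  "tor e1 e1 = 0"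
  "tor e1 e2 = \<beta> *\<^sub>R e3"
  "tor e1 e3 = \<alpha> *\<^sub>R e1 + (\<beta> / 2) *\<^sub>R e2"
  "tor e2 e1 = - (\<beta> *\<^sub>R e3)"
  "tor e2 e2 = 0"
  "tor e2 e3 = - ((\<beta> / 2) *\<^sub>R e1) - \<alpha> *\<^sub>R e2 - \<alpha> *\<^sub>R e3"
  "tor e3 e1 = - (\<alpha> *\<^sub>R e1) - (\<beta> / 2) *\<^sub>R e2"
  "tor e3 e2 = (\<beta> / 2) *\<^sub>R e1 + \<alpha> *\<^sub>R e2 + \<alpha> *\<^sub>R e3"
  "tor e3 e3 = 0"
  by (simp_all add: torsion_def con_basis br_basis algebra_simps flip: scaleR_left.add)

text \<open>Needed because the Wanas tensor iterates the torsion: the outer \<open>tor\<close> is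
  applied to combinations of basis vectors.\<close>

lemma bilinear_tor: "bilinear tor"
  unfolding bilinear_def
  by (intro allI conjI linearI)
    (simp_all add: torsion_def con_simps br_simps algebra_simps)

lemmas tor_simps = bilinear_simps[OF bilinear_tor]

lemma wform_basis:
  "wform e1 e1 = - \<alpha>\<^sup>2 - 3 / 2 * \<beta>\<^sup>2"
  "wform e1 e2 = 2 * \<alpha> * \<beta>"
  "wform e1 e3 = - (\<alpha> * \<beta> / 2)"
  "wform e2 e1 = 2 * \<alpha> * \<beta>"
  "wform e2 e2 = -2 * \<alpha>\<^sup>2 - 3 / 2 * \<beta>\<^sup>2"
  "wform e2 e3 = \<alpha>\<^sup>2"
  "wform e3 e1 = 0"
  "wform e3 e2 = 2 * \<alpha>\<^sup>2"
  "wform e3 e3 = \<beta>\<^sup>2 / 2 - 2 * \<alpha>\<^sup>2"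
  by (simp_all add: wanas_form_def wanas_tensor_def curvature_def br_basis con_basis tor_basis
      br_simps con_simps tor_simps g_simps g_basis power2_eq_square algebra_simps)

text \<open>Pairing with \<open>e3\<close> yields minus the \<open>e3\<close>-coefficient, hence the
  sign change against \<open>wform_basis\<close>. The form is not symmetric, so the first argument
  of \<open>wform\<close> has to be the one fed to \<open>Wan\<close>.\<close>

lemma Wan_basis:
  "Wan e1 = (- \<alpha>\<^sup>2 - 3 / 2 * \<beta>\<^sup>2) *\<^sub>R e1 + (2 * \<alpha> * \<beta>) *\<^sub>R e2 + (\<alpha> * \<beta> / 2) *\<^sub>R e3"
  "Wan e2 = (2 * \<alpha> * \<beta>) *\<^sub>R e1 - (2 * \<alpha>\<^sup>2 + 3 / 2 * \<beta>\<^sup>2) *\<^sub>R e2 - \<alpha>\<^sup>2 *\<^sub>R e3"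
  "Wan e3 = (2 * \<alpha>\<^sup>2) *\<^sub>R e2 + (2 * \<alpha>\<^sup>2 - \<beta>\<^sup>2 / 2) *\<^sub>R e3"
  by (rule eq_by_coordinates;
      simp add: wanas_operator[OF lie metric basis J_linear, symmetric] wform_basis g_simps g_basis)+

lemma not_derivation_up_to_scalar:
  assumes "lie_derivation br D" and Wan: "\<And>X. Wan X = c *\<^sub>R X + D X"
  shows "\<alpha> = 0"
proof -
  have lin: "linear D" and der: "D (br X Y) = br (D X) Y + br X (D Y)" for X Y
    using assms(1) by (auto simp: lie_derivation_def)
  have D_basis: "D e1 = Wan e1 - c *\<^sub>R e1" "D e2 = Wan e2 - c *\<^sub>R e2"
      "D e3 = Wan e3 - c *\<^sub>R e3"
    by (simp_all add: Wan)
  note coordinate_simps = br_basis linear_add[OF lin] linear_diff[OF lin] linear_scale[OF lin]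
    linear_neg[OF lin] D_basis Wan_basis br_simps g_simps g_basis
  \<comment> \<open>The scalar part violates the Leibniz rule by a multiple of \<open>c\<close>
    times the bracket; \<open>br e1 e2\<close> has no \<open>e2\<close>-component, so
    \<open>c\<close> drops out here.\<close>
  have "\<alpha>\<^sup>2 * \<beta> / 2 = 0"
    using arg_cong[OF der[of e1 e2], of "\<lambda>X. g X e2"]
    by (simp add: coordinate_simps) (simp add: algebra_simps power2_eq_square)
  then consider "\<alpha> = 0" | "\<beta> = 0" by auto
  then show ?thesis
  proof cases
    case 2
    \<comment> \<open>For \<beta> = 0 the operator \<open>Wan\<close> itself satisfies this
      coordinate of the Leibniz rule, so only the scalar part remains.\<close>
    have "\<alpha> * c = 0"
      using arg_cong[OF der[of e1 e3], of "\<lambda>X. g X e1"] 2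
      by (simp add: coordinate_simps) (simp add: algebra_simps power2_eq_square)
    \<comment> \<open>Here \<open>Wan\<close> does contribute: its defect is the cubic term.\<close>
    moreover have "\<alpha> ^ 3 + \<alpha> * c = 0"
      using arg_cong[OF der[of e1 e2], of "\<lambda>X. g X e1"] 2
      by (simp add: coordinate_simps) (simp add: algebra_simps power2_eq_square power3_eq_cube)
    ultimately show ?thesis by auto
  qed
qed

end

theorem theorem2p4:
  fixes \<alpha> \<beta> :: real
    and br :: "'a::real_vector \<Rightarrow> 'a \<Rightarrow> 'a"
    and g :: "'a \<Rightarrow> 'a \<Rightarrow> real"
    and J :: "'a \<Rightarrow> 'a"
    and e1 e2 e3 :: 'a
  assumes "\<alpha> \<noteq> 0"
    and "lie_bracket br"
    and "left_invariant_metric g"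
    and "pseudo_orthonormal_basis g e1 e2 e3"
    and "br e1 e2 = \<alpha> *\<^sub>R e1 - \<beta> *\<^sub>R e3"
    and "br e1 e3 = - (\<alpha> *\<^sub>R e1) - \<beta> *\<^sub>R e2"
    and "br e2 e3 = \<beta> *\<^sub>R e1 + \<alpha> *\<^sub>R e2 + \<alpha> *\<^sub>R e3"
    and "linear J"
    and "J e1 = e1" "J e2 = e2" "J e3 = - e3"
  shows "\<not> first_kind_algebraic_wanas_soliton br g J e1 e2 e3"
proof -
  interpret lorentzian_G1 \<alpha> \<beta> br g J e1 e2 e3
    by (rule lorentzian_G1.intro) (fact assms)+
  show ?thesis
    using not_derivation_up_to_scalar assms(1)
    unfolding first_kind_algebraic_wanas_soliton_def by blast
qed

end
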